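(* The set of two-player zero-sum games in which a given player has a unique optimal strategy is not open: there exist integers $m_1,m_2$ such that the set of real $m_1\times m_2$ matrices $A$ for which the row player (the maximizer) has a unique optimal mixed strategy in the zero-sum game with payoff matrix $A$ is not an open subset of $\mathbb{R}^{m_1\times m_2}$.
   Context: In the two-player zero-sum game with payoff matrix $A\in\mathbb{R}^{m_1\times m_2}$, the row player chooses a mixed strategy $x$ in the simplex of $\mathbb{R}^{m_1}$, the column player a mixed strategy $y$ in the simplex of $\mathbb{R}^{m_2}$, and the row player receives $x^{T}Ay$ from the column player. A mixed strategy $x$ of the row player is optimal if it maximizes $\min_y x^{T}Ay$. *)

theory Defs
  imports "HOL-Analysis.Analysis"
begin

(* Since the dimensions are quantified inside the statement, vectors in R^m and
   m1 x m2 matrices are extensional real functions on {..<m} and {..<m1} \<times> {..<m2}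
   (indices start at 0). Extensionality makes equality of functions coincide with
   equality of vectors and matrices. *)

definition mixed_strategies :: "nat \<Rightarrow> (nat \<Rightarrow> real) set" where
  "mixed_strategies m =
     {x \<in> {..<m} \<rightarrow>\<^sub>E UNIV. (\<forall>i<m. 0 \<le> x i) \<and> (\<Sum>i<m. x i) = 1}"

definition payoff :: "nat \<Rightarrow> nat \<Rightarrow> (nat \<times> nat \<Rightarrow> real) \<Rightarrow> (nat \<Rightarrow> real) \<Rightarrow> (nat \<Rightarrow> real) \<Rightarrow> real" where
  "payoff m1 m2 A x y = (\<Sum>i<m1. \<Sum>j<m2. x i * A (i, j) * y j)"

(* The infimum is a minimum whenever m2 > 0: see guaranteed_payoff_attained. *)
definition guaranteed_payoff :: "nat \<Rightarrow> nat \<Rightarrow> (nat \<times> nat \<Rightarrow> real) \<Rightarrow> (nat \<Rightarrow> real) \<Rightarrow> real" where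
  "guaranteed_payoff m1 m2 A x = (INF y\<in>mixed_strategies m2. payoff m1 m2 A x y)"

definition optimal_row_strategy :: "nat \<Rightarrow> nat \<Rightarrow> (nat \<times> nat \<Rightarrow> real) \<Rightarrow> (nat \<Rightarrow> real) \<Rightarrow> bool" where
  "optimal_row_strategy m1 m2 A x \<longleftrightarrow>
     x \<in> mixed_strategies m1 \<and>
     (\<forall>x'\<in>mixed_strategies m1. guaranteed_payoff m1 m2 A x' \<le> guaranteed_payoff m1 m2 A x)"

definition real_matrices :: "nat \<Rightarrow> nat \<Rightarrow> (nat \<times> nat \<Rightarrow> real) set" where
  "real_matrices m1 m2 = {..<m1} \<times> {..<m2} \<rightarrow>\<^sub>E UNIV"

(* The product topology of finitely many copies of the real line,
   i.e. the usual topology of the space of m1 x m2 matrices. *)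
abbreviation matrix_topology :: "nat \<Rightarrow> nat \<Rightarrow> (nat \<times> nat \<Rightarrow> real) topology" where
  "matrix_topology m1 m2 \<equiv> powertop_real ({..<m1} \<times> {..<m2})"

lemma topspace_matrix_topology: "topspace (matrix_topology m1 m2) = real_matrices m1 m2"
  by (simp add: real_matrices_def)

lemma guaranteed_payoff_attained:
  assumes "0 < m2"
  obtains y where "y \<in> mixed_strategies m2"
    and "payoff m1 m2 A x y = guaranteed_payoff m1 m2 A x"
    and "\<And>y'. y' \<in> mixed_strategies m2 \<Longrightarrow> payoff m1 m2 A x y \<le> payoff m1 m2 A x y'"
proof -
  define c where "c j = (\<Sum>i<m1. x i * A (i, j))" for j
  have p: "payoff m1 m2 A x y = (\<Sum>j<m2. c j * y j)" for y
    unfolding payoff_def c_def by (subst sum.swap) (simp add: sum_distrib_right)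
  define k where "k = arg_min_on c {..<m2}"
  have k: "k < m2" "\<And>j. j < m2 \<Longrightarrow> c k \<le> c j"
    using assms arg_min_if_finite(1)[of "{..<m2}" c] arg_min_least[of "{..<m2}" _ c]
    by (auto simp: k_def lessThan_empty_iff)
  define y where "y = (\<lambda>j\<in>{..<m2}. if j = k then 1 else 0 :: real)"
  have y: "y \<in> mixed_strategies m2"
    using k(1) by (auto simp: mixed_strategies_def y_def)
  have "(\<Sum>j<m2. c j * y j) = (\<Sum>j<m2. if j = k then c k else 0)"
    by (rule sum.cong) (auto simp: y_def)
  then have py: "payoff m1 m2 A x y = c k"
    using k(1) by (simp add: p)
  have min: "payoff m1 m2 A x y \<le> payoff m1 m2 A x y'" if y': "y' \<in> mixed_strategies m2" for y'
  proof -
    have "c k = (\<Sum>j<m2. c k * y' j)"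
      using y' by (simp add: mixed_strategies_def flip: sum_distrib_left)
    also have "\<dots> \<le> (\<Sum>j<m2. c j * y' j)"
      using y' k(2) by (intro sum_mono mult_right_mono) (auto simp: mixed_strategies_def)
    finally show ?thesis by (simp add: p py[unfolded p])
  qed
  have "guaranteed_payoff m1 m2 A x = payoff m1 m2 A x y"
    unfolding guaranteed_payoff_def using y min by (intro cInf_eq_minimum) auto
  with y min show thesis by (intro that[of y]) auto
qed

end

(* Let E(e) be the 3 x 2 game whose columns pay the row player - x 0 and e - x 1, so that x
   guarantees min (- x 0) (e - x 1). In E(0) the only optimal strategy is the last row. For
   0 < e < 1 the second column is slack near the last row, so moving weight e from the last to
   the middle row loses nothing and the optimal strategy is not unique. As E is continuous,
   E(0) is not an interior point. *)

theory Submission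
  imports Defs
begin

text \<open>The payoff is linear in \<open>y\<close>, so against a fixed \<open>x\<close> each mixed
  reply yields a weighted average of the two column payoffs, and the cheaper pure column attains the
  minimum.\<close>

lemma guaranteed_payoff_two_columns:
  "guaranteed_payoff m 2 A x = min (\<Sum>i<m. x i * A (i, 0)) (\<Sum>i<m. x i * A (i, 1))"
    (is "_ = min ?c0 ?c1")
proof -
  have p: "payoff m 2 A x y = ?c0 * y 0 + ?c1 * y 1" for y
    by (simp add: payoff_def numeral_2_eq_2 sum.distrib sum_distrib_right)
  define e where "e k = (\<lambda>j\<in>{..<2}. if j = k then 1 else 0 :: real)" for k :: nat
  have e: "e 0 \<in> mixed_strategies 2" "e 1 \<in> mixed_strategies 2"
    by (auto simp: mixed_strategies_def e_def numeral_2_eq_2)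
  have e_simps: "e 0 0 = 1" "e 0 1 = 0" "e 1 0 = 0" "e 1 1 = 1"
    by (simp_all add: e_def)
  have pe: "payoff m 2 A x (e 0) = ?c0" "payoff m 2 A x (e 1) = ?c1"
    by (simp_all only: p e_simps mult_1_right mult_zero_right add_0_left add_0_right)
  have ge: "min ?c0 ?c1 \<le> payoff m 2 A x y" if "y \<in> mixed_strategies 2" for y
  proof -
    have y: "0 \<le> y 0" "0 \<le> y 1" "y 0 + y 1 = 1"
      using that by (auto simp: mixed_strategies_def numeral_2_eq_2)
    have "min ?c0 ?c1 = min ?c0 ?c1 * y 0 + min ?c0 ?c1 * y 1"
      by (simp only: y(3) mult_1_right flip: distrib_left)
    also have "\<dots> \<le> ?c0 * y 0 + ?c1 * y 1"
      using y by (intro add_mono mult_right_mono) auto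
    finally show ?thesis by (simp add: p)
  qed
  show ?thesis
    unfolding guaranteed_payoff_def
  proof (rule cInf_eq_minimum)
    show "min ?c0 ?c1 \<in> payoff m 2 A x ` mixed_strategies 2"
      using imageI[OF e(1), of "payoff m 2 A x"] imageI[OF e(2), of "payoff m 2 A x"]
      unfolding pe min_def by presburger
    show "min ?c0 ?c1 \<le> v" if "v \<in> payoff m 2 A x ` mixed_strategies 2" for v
      using that ge by blast
  qed
qed

text \<open>This is E(e), with rows (-1, e), (0, e - 1), (0, e). The constant e in the payoff of the
  second column is encoded by adding e to every entry of that column.\<close>

definition slack_game :: "real \<Rightarrow> nat \<times> nat \<Rightarrow> real" where
  "slack_game e = (\<lambda>(i, j)\<in>{..<3} \<times> {..<2}.
     if j = 0 then (if i = 0 then - 1 else 0) else (if i = 1 then e - 1 else e))"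

lemma slack_game_real_matrices: "slack_game e \<in> real_matrices 3 2"
  by (simp add: slack_game_def real_matrices_def)

lemma guaranteed_payoff_slack_game:
  assumes "x \<in> mixed_strategies 3"
  shows "guaranteed_payoff 3 2 (slack_game e) x = min (- x 0) (e - x 1)"
proof -
  have "x 0 + x 1 + x 2 = 1"
    using assms by (simp add: mixed_strategies_def eval_nat_numeral)
  \<comment> \<open>Since the weights sum to 1, the shift of the second column contributes exactly
    e.\<close>
  then have "e * x 0 + e * x 1 + e * x 2 = e"
    by (metis distrib_left mult.right_neutral)
  then show ?thesis
    unfolding guaranteed_payoff_two_columns
    by (simp add: slack_game_def eval_nat_numeral algebra_simps)
qed

lemma continuous_map_slack_game:
  "continuous_map euclideanreal (matrix_topology 3 2) slack_game"
  unfolding continuous_map_componentwise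
proof (intro conjI ballI)
  fix k :: "nat \<times> nat"
  assume "k \<in> {..<3} \<times> {..<2}"
  then show "continuous_map euclideanreal euclideanreal (\<lambda>e. slack_game e k)"
    by (cases k; cases "fst k = 1") (auto simp: slack_game_def intro!: continuous_intros)
qed (auto simp: slack_game_def)

definition last_rows_strategy :: "real \<Rightarrow> nat \<Rightarrow> real" where
  "last_rows_strategy t = (\<lambda>i\<in>{..<3}. if i = 0 then 0 else if i = 1 then t else 1 - t)"

lemma last_rows_strategy_mixed:
  assumes "0 \<le> t" "t \<le> 1"
  shows "last_rows_strategy t \<in> mixed_strategies 3"
  using assms by (auto simp: mixed_strategies_def last_rows_strategy_def eval_nat_numeral)

text \<open>The first column holds every strategy to - x 0 \<le> 0. This bound is attained here: row
  0 has weight 0, and the second column pays e - t \<ge> 0.\<close>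

lemma optimal_last_rows_strategy:
  assumes "0 \<le> t" "t \<le> e" "t \<le> 1"
  shows "optimal_row_strategy 3 2 (slack_game e) (last_rows_strategy t)"
proof -
  have "guaranteed_payoff 3 2 (slack_game e) (last_rows_strategy t) = 0"
    using assms by (simp add: guaranteed_payoff_slack_game last_rows_strategy_mixed)
      (simp add: last_rows_strategy_def)
  then show ?thesis
    using assms last_rows_strategy_mixed
    by (auto simp: optimal_row_strategy_def guaranteed_payoff_slack_game mixed_strategies_def
        min_le_iff_disj)
qed

text \<open>At e = 0 the guarantee is min (- x 0) (- x 1), so reaching the value 0 forces both
  weights to vanish.\<close>

lemma optimal_row_strategy_slack_game_0:
  assumes "optimal_row_strategy 3 2 (slack_game 0) x"
  shows "x = last_rows_strategy 0"
proof -
  have x: "x \<in> mixed_strategies 3"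
    using assms by (simp add: optimal_row_strategy_def)
  have "guaranteed_payoff 3 2 (slack_game 0) (last_rows_strategy 0)
      \<le> guaranteed_payoff 3 2 (slack_game 0) x"
    using assms last_rows_strategy_mixed[of 0] by (simp add: optimal_row_strategy_def)
  then have "x 0 \<le> 0" "x 1 \<le> 0"
    using x by (simp_all add: guaranteed_payoff_slack_game last_rows_strategy_mixed)
      (simp_all add: last_rows_strategy_def)
  moreover have "0 \<le> x 0" "0 \<le> x 1" "x 0 + x 1 + x 2 = 1"
    using x by (simp_all add: mixed_strategies_def eval_nat_numeral)
  ultimately have "x 0 = 0" "x 1 = 0" "x 2 = 1"
    by auto
  \<comment> \<open>Equality of functions also needs agreement outside the index set, which
    extensionality provides.\<close>
  moreover have "x i = undefined" if "\<not> i < 3" for i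
    using x that by (auto simp: mixed_strategies_def PiE_def extensional_def)
  moreover have "i = 0 \<or> i = 1 \<or> i = 2" if "i < 3" for i :: nat
    using that by auto
  ultimately show ?thesis
    by (force simp: last_rows_strategy_def restrict_def)
qed

theorem mainTheorem10:
  shows "\<exists>m1 m2. 0 < m1 \<and> 0 < m2 \<and>
    \<not> openin (matrix_topology m1 m2)
        {A \<in> real_matrices m1 m2. \<exists>!x. optimal_row_strategy m1 m2 A x}"
proof -
  define U where "U = {A \<in> real_matrices 3 2. \<exists>!x. optimal_row_strategy 3 2 A x}"
  have "\<not> openin (matrix_topology 3 2) U"
  proof
    assume "openin (matrix_topology 3 2) U"
    \<comment> \<open>Continuity pulls \<open>U\<close> back to the real line, where it suffices to
      perturb the single parameter e around 0.\<close>
    then have "open {e. slack_game e \<in> U}"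
      using openin_continuous_map_preimage[OF continuous_map_slack_game] by auto
    moreover have "slack_game 0 \<in> U"
      using optimal_last_rows_strategy[of 0 0] optimal_row_strategy_slack_game_0
        slack_game_real_matrices by (auto simp: U_def)
    ultimately obtain d where d: "0 < d" "\<And>e. \<bar>e\<bar> < d \<Longrightarrow> slack_game e \<in> U"
      by (auto simp: open_dist dist_real_def)
    \<comment> \<open>Halving \<open>d\<close> keeps the game in \<open>U\<close>; the cap at 1
      makes \<open>last_rows_strategy e\<close> a mixed strategy.\<close>
    define e where "e = min (d / 2) 1"
    have e: "0 < e" "e \<le> 1" "\<bar>e\<bar> < d"
      using d(1) by (auto simp: e_def)
    \<comment> \<open>Both t = 0 and t = e are optimal in \<open>slack_game e\<close>, so uniqueness
      would identify them, although their weights on row 1 differ.\<close>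
    have "last_rows_strategy 0 = last_rows_strategy e"
      using d(2)[OF e(3)] optimal_last_rows_strategy[of 0 e] optimal_last_rows_strategy[of e e] e
      by (auto simp: U_def)
    then have "last_rows_strategy 0 1 = last_rows_strategy e 1"
      by simp
    with e(1) show False
      by (simp add: last_rows_strategy_def)
  qed
  then show ?thesis
    by (intro exI[of _ 3] exI[of _ 2]) (simp add: U_def)
qed

end
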